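(* The stretch of the two-tree construction described in the context is at least $\sqrt{26}$; that is, the supremum, over all finite point sets $P\subset\mathbb{R}^2$ with $|P|\ge 2$ and all axis-aligned squares $S_R\supseteq P$, of the stretch of the pair of trees $\{T_R,T_B\}$ on $P$ is at least $\sqrt{26}$.
   Context: Construction. Let $P\subset\mathbb{R}^2$ be finite with $|P|\ge 2$ and let $\delta$ be the minimum pairwise Euclidean distance in $P$. Let $S_R$ be an axis-aligned square containing $P$, and let $S_B$ be the square obtained from $S_R$ by rotating it by $\pi/4$ about its center and scaling it up by a factor $\sqrt2$ about its center (so the midpoints of the sides of $S_B$ are the corners of $S_R$). The red tree $T_R$ is the output of $\textsc{Tree}(S_R,P)$ and the blue tree $T_B$ is the output of $\textsc{Tree}(S_B,P)$, where, for a square $S$ with center $o$ and a finite set $Q\subset S$, the recursive procedure $\textsc{Tree}(S,Q)$ is: if $\operatorname{diam}(S)\le\delta/8$, return the single edge $\{o,p\}$ if $Q=\{p\}$, and return the empty edge set if $Q=\emptyset$ ($Q$ has at most one point in this case); otherwise, partition $S$ into four equal squares $A,B,C,D$ with centers $a,b,c,d$, and return the edges $(o,a),(o,b),(o,c),(o,d)$ together with the edges returned by $\textsc{Tree}(A,Q\cap A)$, $\textsc{Tree}(B,Q\cap B)$, $\textsc{Tree}(C,Q\cap C)$, $\textsc{Tree}(D,Q\cap D)$, where a point of $Q$ belonging to more than one of the four squares is passed to only one of them (ties broken arbitrarily), and if $o\in Q$ then $o$ is passed to none of them. The number $\delta$ is fixed for all recursive calls, and every edge is weighted by its Euclidean length.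 The stretch of $\{T_R,T_B\}$ on $P$ is $\max_{x\ne y\in P}\ \min_{T\in\{T_R,T_B\}} d_T(x,y)/\|x-y\|$, where $d_T$ is the weighted shortest-path distance in $T$. *)

theory Defs
  imports "HOL-Analysis.Analysis" "Graph_Theory.Shortest_Path"
begin

section \<open>Squares in the plane\<close>

definition rotate_plane :: "real \<Rightarrow> real^2 \<Rightarrow> real^2" where
  "rotate_plane \<theta> v = vector [cos \<theta> * v$1 - sin \<theta> * v$2, sin \<theta> * v$1 + cos \<theta> * v$2]"

text \<open>A square is given by its centre \<open>c\<close> and the vector \<open>u\<close> from \<open>c\<close> to the midpoint of one of
  its sides.\<close>

definition square :: "real^2 \<Rightarrow> real^2 \<Rightarrow> (real^2) set" where
  "square c u = {c + s *\<^sub>R u + t *\<^sub>R rotate_plane (pi/2) u | s t. \<bar>s\<bar> \<le> 1 \<and> \<bar>t\<bar> \<le> 1}"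

text \<open>The four quarters of \<open>square c u\<close> are \<open>square a ((1/2) *\<^sub>R u)\<close> for \<open>a \<in> quarter_centres c u\<close>.\<close>

definition quarter_centres :: "real^2 \<Rightarrow> real^2 \<Rightarrow> (real^2) set" where
  "quarter_centres c u =
     {c + (s/2) *\<^sub>R u + (t/2) *\<^sub>R rotate_plane (pi/2) u | s t. s \<in> {-1, 1} \<and> t \<in> {-1, 1}}"

definition red_vec :: "real \<Rightarrow> real^2" where
  "red_vec h = vector [h, 0]"

definition blue_vec :: "real \<Rightarrow> real^2" where
  "blue_vec h = sqrt 2 *\<^sub>R rotate_plane (pi/4) (red_vec h)"

section \<open>The recursive construction\<close>

definition min_dist :: "(real^2) set \<Rightarrow> real" where
  "min_dist P = Min {dist x y | x y. x \<in> P \<and> y \<in> P \<and> x \<noteq> y}"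

text \<open>\<open>quad_tree \<delta> c u Q E\<close>: the edge set \<open>E\<close> is a possible output of the procedure on
  \<open>square c u\<close> and \<open>Q\<close>. It is a relation because ties are broken arbitrarily: in the last rule
  \<open>Qs a\<close> is the set of points passed to the quarter with centre \<open>a\<close>.
  An edge is the set of its two end points, which are identified with points of the plane.\<close>

inductive quad_tree ::
  "real \<Rightarrow> real^2 \<Rightarrow> real^2 \<Rightarrow> (real^2) set \<Rightarrow> (real^2) set set \<Rightarrow> bool" for \<delta> :: real where
  leaf_empty: "diameter (square c u) \<le> \<delta>/8 \<Longrightarrow> quad_tree \<delta> c u {} {}"
| leaf_point: "diameter (square c u) \<le> \<delta>/8 \<Longrightarrow> quad_tree \<delta> c u {p} {{c, p}}"
| split:
    "\<lbrakk>diameter (square c u) > \<delta>/8;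
      (\<Union>a\<in>quarter_centres c u. Qs a) = Q - {c};
      disjoint_family_on Qs (quarter_centres c u);
      \<forall>a\<in>quarter_centres c u. Qs a \<subseteq> square a ((1/2) *\<^sub>R u);
      \<forall>a\<in>quarter_centres c u. quad_tree \<delta> a ((1/2) *\<^sub>R u) (Qs a) (Es a)\<rbrakk>
     \<Longrightarrow> quad_tree \<delta> c u Q (\<Union>a\<in>quarter_centres c u. insert {c, a} (Es a))"

definition admissible :: "(real^2) set \<Rightarrow> real^2 \<Rightarrow> real \<Rightarrow> bool" where
  "admissible P c h \<longleftrightarrow> finite P \<and> 2 \<le> card P \<and> 0 < h \<and> P \<subseteq> square c (red_vec h)"

definition red_tree :: "(real^2) set \<Rightarrow> real^2 \<Rightarrow> real \<Rightarrow> (real^2) set set \<Rightarrow> bool" where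
  "red_tree P c h = quad_tree (min_dist P) c (red_vec h) P"

definition blue_tree :: "(real^2) set \<Rightarrow> real^2 \<Rightarrow> real \<Rightarrow> (real^2) set set \<Rightarrow> bool" where
  "blue_tree P c h = quad_tree (min_dist P) c (blue_vec h) P"

section \<open>Tree distance and stretch\<close>

text \<open>The symmetric digraph of an undirected edge set.\<close>

definition graph_of :: "'a set set \<Rightarrow> ('a, 'a \<times> 'a) pre_digraph" where
  "graph_of E = \<lparr>verts = \<Union>E, arcs = {(x, y). {x, y} \<in> E}, tail = fst, head = snd\<rparr>"

definition tree_dist :: "(real^2) set set \<Rightarrow> real^2 \<Rightarrow> real^2 \<Rightarrow> ereal" where
  "tree_dist E x y = wf_digraph.\<mu> (graph_of E) (\<lambda>(a, b). dist a b) x y"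

definition stretch :: "(real^2) set set set \<Rightarrow> (real^2) set \<Rightarrow> ereal" where
  "stretch \<T> P =
     Max {Min ((\<lambda>T. tree_dist T x y / ereal (dist x y)) ` \<T>) | x y. x \<in> P \<and> y \<in> P \<and> x \<noteq> y}"

section \<open>Basic facts\<close>

lemma wf_digraph_graph_of: "wf_digraph (graph_of E)"
  by (auto simp: wf_digraph_def graph_of_def)

lemma rotate_plane_quarter: "rotate_plane (pi/2) v = vector [- v$2, v$1]"
  by (simp add: rotate_plane_def)

text \<open>The sides of the blue square have the corners of the red square as their midpoints.\<close>

lemma blue_vec_eq: "blue_vec h = red_vec h + rotate_plane (pi/2) (red_vec h)"
  by (simp add: blue_vec_def red_vec_def rotate_plane_def vec_eq_iff forall_2 cos_45 sin_45)

lemma rotate_plane_scaleR: "rotate_plane \<theta> (r *\<^sub>R v) = r *\<^sub>R rotate_plane \<theta> v"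
  by (simp add: rotate_plane_def vec_eq_iff forall_2 algebra_simps)

lemma norm_rotate_plane_quarter: "norm (rotate_plane (pi/2) v) = norm v"
  by (simp add: rotate_plane_quarter norm_vec_def L2_set_def sum_2 add.commute)

lemma square_dist_le:
  assumes "x \<in> square c u" "y \<in> square c u"
  shows "norm (x - y) \<le> 4 * norm u"
proof -
  have *: "norm (z - c) \<le> 2 * norm u" if "z \<in> square c u" for z
  proof -
    from that obtain s t where st: "\<bar>s\<bar> \<le> 1" "\<bar>t\<bar> \<le> 1"
      and z: "z - c = s *\<^sub>R u + t *\<^sub>R rotate_plane (pi/2) u"
      by (auto simp: square_def)
    have "norm (z - c) \<le> \<bar>s\<bar> * norm u + \<bar>t\<bar> * norm u"
      unfolding z using norm_triangle_ineq[of "s *\<^sub>R u" "t *\<^sub>R rotate_plane (pi/2) u"]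
      by (simp add: norm_rotate_plane_quarter)
    also have "\<dots> \<le> 1 * norm u + 1 * norm u"
      using st by (intro add_mono mult_right_mono) auto
    finally show ?thesis by simp
  qed
  have "norm (x - y) \<le> norm (x - c) + norm (y - c)"
    using norm_triangle_ineq4[of "x - c" "y - c"] by simp
  with *[OF assms(1)] *[OF assms(2)] show ?thesis by simp
qed

lemma diameter_square_le: "diameter (square c u) \<le> 4 * norm u"
  by (rule diameter_le) (auto intro: square_dist_le)

lemma bounded_square: "bounded (square c u)"
  unfolding bounded_two_points dist_norm using square_dist_le by blast

lemma square_subset_quarters:
  "square c u \<subseteq> (\<Union>a\<in>quarter_centres c u. square a ((1/2) *\<^sub>R u))"
proof
  fix z assume "z \<in> square c u"
  then obtain s t where st: "\<bar>s\<bar> \<le> 1" "\<bar>t\<bar> \<le> 1"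
    and z: "z = c + s *\<^sub>R u + t *\<^sub>R rotate_plane (pi/2) u"
    by (auto simp: square_def)
  define s' t' :: real where "s' = (if s \<ge> 0 then 1 else -1)" and "t' = (if t \<ge> 0 then 1 else -1)"
  define a where "a = c + (s'/2) *\<^sub>R u + (t'/2) *\<^sub>R rotate_plane (pi/2) u"
  have "a \<in> quarter_centres c u"
    unfolding quarter_centres_def a_def
    by (intro CollectI exI[of _ s'] exI[of _ t'] conjI refl) (auto simp: s'_def t'_def)
  moreover have "z \<in> square a ((1/2) *\<^sub>R u)"
    unfolding square_def
  proof (intro CollectI exI conjI)
    show "z = a + (2 * s - s') *\<^sub>R ((1/2) *\<^sub>R u) + (2 * t - t') *\<^sub>R rotate_plane (pi/2) ((1/2) *\<^sub>R u)"
      by (simp add: z a_def rotate_plane_scaleR algebra_simps vec_eq_iff)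
    show "\<bar>2 * s - s'\<bar> \<le> 1" "\<bar>2 * t - t'\<bar> \<le> 1"
      using st by (auto simp: s'_def t'_def)
  qed
  ultimately show "z \<in> (\<Union>a\<in>quarter_centres c u. square a ((1/2) *\<^sub>R u))" by blast
qed

text \<open>The procedure terminates, so it always has an output.\<close>

lemma quad_tree_exists_aux:
  assumes "0 < \<delta>" "\<And>x y. x \<in> P \<Longrightarrow> y \<in> P \<Longrightarrow> x \<noteq> y \<Longrightarrow> \<delta> \<le> dist x y"
    and "Q \<subseteq> P" "Q \<subseteq> square c u" "4 * norm u \<le> 2 ^ n * (\<delta>/8)"
  shows "\<exists>E. quad_tree \<delta> c u Q E"
  using assms(3-5)
proof (induction n arbitrary: c u Q)
  case 0
  have D: "diameter (square c u) \<le> \<delta>/8"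
    using diameter_square_le[of c u] 0 by simp
  have "x = y" if "x \<in> Q" "y \<in> Q" for x y
  proof (rule ccontr)
    assume "x \<noteq> y"
    then have "\<delta> \<le> dist x y" using assms(2) that 0 by blast
    moreover have "dist x y \<le> 4 * norm u"
      using square_dist_le that 0 by (metis dist_norm subsetD)
    ultimately show False using 0 assms(1) by simp
  qed
  then have "Q = {} \<or> (\<exists>p. Q = {p})" by blast
  then show ?case using leaf_empty[OF D] leaf_point[OF D] by blast
next
  case (Suc n)
  show ?case
  proof (cases "diameter (square c u) \<le> \<delta>/8")
    case D: True
    have "x = y" if "x \<in> Q" "y \<in> Q" for x y
    proof (rule ccontr)
      assume "x \<noteq> y"
      then have "\<delta> \<le> dist x y" using assms(2) that Suc.prems by blast
      moreover have "dist x y \<le> diameter (square c u)"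
        using diameter_bounded_bound[OF bounded_square] that Suc.prems by blast
      ultimately show False using D assms(1) by simp
    qed
    then have "Q = {} \<or> (\<exists>p. Q = {p})" by blast
    then show ?thesis using leaf_empty[OF D] leaf_point[OF D] by blast
  next
    case False
    have "\<forall>z\<in>Q. \<exists>a. a \<in> quarter_centres c u \<and> z \<in> square a ((1/2) *\<^sub>R u)"
      using square_subset_quarters[of c u] Suc.prems(2) by blast
    then obtain f where f: "\<And>z. z \<in> Q \<Longrightarrow> f z \<in> quarter_centres c u"
      "\<And>z. z \<in> Q \<Longrightarrow> z \<in> square (f z) ((1/2) *\<^sub>R u)"
      by metis
    define Qs where "Qs a = {z \<in> Q - {c}. f z = a}" for a
    have "\<exists>E. quad_tree \<delta> a ((1/2) *\<^sub>R u) (Qs a) E" for a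
      using Suc.prems f(2) by (intro Suc.IH) (auto simp: Qs_def mult.commute)
    then obtain Es where Es: "\<And>a. quad_tree \<delta> a ((1/2) *\<^sub>R u) (Qs a) (Es a)"
      by metis
    have "quad_tree \<delta> c u Q (\<Union>a\<in>quarter_centres c u. insert {c, a} (Es a))"
      using False f Es by (intro split[where Qs = Qs]) (auto simp: Qs_def disjoint_family_on_def)
    then show ?thesis by blast
  qed
qed

lemma min_dist_props:
  assumes "finite P" "2 \<le> card P"
  shows "0 < min_dist P" "\<And>x y. x \<in> P \<Longrightarrow> y \<in> P \<Longrightarrow> x \<noteq> y \<Longrightarrow> min_dist P \<le> dist x y"
proof -
  let ?D = "{dist x y | x y. x \<in> P \<and> y \<in> P \<and> x \<noteq> y}"
  have "?D \<subseteq> (\<lambda>(x, y). dist x y) ` (P \<times> P)" by auto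
  then have fin: "finite ?D" using assms(1) finite_subset by blast
  obtain x y where "x \<in> P" "y \<in> P" "x \<noteq> y"
    using assms by (metis card_le_Suc0_iff_eq not_less_eq_eq numeral_2_eq_2)
  then have "?D \<noteq> {}" by blast
  then show "0 < min_dist P" using fin unfolding min_dist_def by (subst Min_gr_iff) auto
  show "min_dist P \<le> dist x y" if "x \<in> P" "y \<in> P" "x \<noteq> y" for x y
    unfolding min_dist_def using fin that by (intro Min_le) auto
qed

lemma quad_tree_exists:
  assumes "finite P" "2 \<le> card P" "P \<subseteq> square c u"
  shows "\<exists>E. quad_tree (min_dist P) c u P E"
proof -
  have d: "0 < min_dist P" using min_dist_props assms by blast
  obtain n where "4 * norm u / (min_dist P / 8) < 2 ^ n"
    using real_arch_pow[of 2] by auto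
  then have "4 * norm u \<le> 2 ^ n * (min_dist P / 8)"
    using d by (simp add: field_simps)
  then show ?thesis
    using quad_tree_exists_aux[of "min_dist P" P P c u n] min_dist_props assms by blast
qed

lemma red_subset_blue: "square c (red_vec h) \<subseteq> square c (blue_vec h)"
proof
  fix z assume "z \<in> square c (red_vec h)"
  then obtain s t where st: "\<bar>s\<bar> \<le> 1" "\<bar>t\<bar> \<le> 1"
    and z: "z = c + s *\<^sub>R red_vec h + t *\<^sub>R rotate_plane (pi/2) (red_vec h)"
    by (auto simp: square_def)
  show "z \<in> square c (blue_vec h)"
    unfolding square_def
  proof (intro CollectI exI conjI)
    show "z = c + ((s + t)/2) *\<^sub>R blue_vec h + ((t - s)/2) *\<^sub>R rotate_plane (pi/2) (blue_vec h)"
      by (simp add: z blue_vec_eq rotate_plane_quarter red_vec_def vec_eq_iff forall_2 field_simps)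
    show "\<bar>(s + t)/2\<bar> \<le> 1" "\<bar>(t - s)/2\<bar> \<le> 1" using st by auto
  qed
qed

lemma red_blue_trees_exist:
  assumes "admissible P c h"
  shows "\<exists>T. red_tree P c h T" "\<exists>T. blue_tree P c h T"
  using assms quad_tree_exists red_subset_blue
  unfolding admissible_def red_tree_def blue_tree_def by (blast, meson subset_trans)

end

theory Submission
  imports Defs
begin

text \<open>The stretch is in fact unbounded, because the centre of the two squares lies on the midlines
  of both. For points \<open>p\<close> and \<open>- p\<close> near the centre, separated by one midline of each square, every
  path in either tree passes through the root along two root edges, so its length is bounded below
  independently of \<open>p\<close>. This is witnessed by a potential that is 1-Lipschitz along the edges: a
  constant times the sign of the coordinate along \<open>u\<close>. The choice \<open>p = (1/8, 0)\<close> in the square of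
  half-side 1 already gives stretch at least \<open>4 * sqrt 2 = sqrt 32\<close>.\<close>

lemma inner_rotate_plane_quarter: "inner u (rotate_plane (pi/2) u) = 0"
  by (simp add: rotate_plane_quarter inner_vec_def sum_2)

text \<open>Midpoints of opposite sides are \<open>2 * norm u\<close> apart. This rules out the leaf
  rules at the root of a large square.\<close>

lemma diameter_square_ge: "2 * norm u \<le> diameter (square c u)"
proof -
  have "c + u \<in> square c u"
    unfolding square_def by (intro CollectI exI[of _ 1] exI[of _ 0]) simp
  moreover have "c - u \<in> square c u"
    unfolding square_def by (intro CollectI exI[of _ "-1"] exI[of _ 0]) simp
  ultimately have "dist (c + u) (c - u) \<le> diameter (square c u)"
    by (rule diameter_bounded_bound[OF bounded_square])
  moreover have "dist (c + u) (c - u) = norm (2 *\<^sub>R u)"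
    by (simp add: dist_norm scaleR_2)
  ultimately show ?thesis by simp
qed

lemma inner_square_ge:
  assumes "z \<in> square c u" "inner w (rotate_plane (pi/2) u) = 0"
  shows "inner w c - \<bar>inner w u\<bar> \<le> inner w z"
proof -
  from assms obtain s t where "\<bar>s\<bar> \<le> 1" and z: "inner w z = inner w c + s * inner w u"
    by (auto simp: square_def inner_add_right)
  then have "\<bar>s * inner w u\<bar> \<le> \<bar>inner w u\<bar>"
    by (simp add: abs_mult mult_left_le_one_le)
  then show ?thesis unfolding z by linarith
qed

text \<open>The bound on \<open>inner w c\<close> says that the square lies in the half-plane \<open>inner w v \<ge> 0\<close>.\<close>

lemma quad_tree_half_plane:
  assumes "quad_tree \<delta> c u Q E"
    and "inner w (rotate_plane (pi/2) u) = 0" "inner w u \<noteq> 0" "\<bar>inner w u\<bar> \<le> inner w c"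
    and "\<And>q. q \<in> Q \<Longrightarrow> 0 < inner w q"
    and "e \<in> E" "v \<in> e"
  shows "0 < inner w v"
  using assms
proof (induction arbitrary: e v)
  case (split c u Qs Q Es)
  have child: "inner w ((1/2) *\<^sub>R u) \<noteq> 0"
    "inner w (rotate_plane (pi/2) ((1/2) *\<^sub>R u)) = 0"
    using split.prems by (simp_all add: rotate_plane_scaleR)
  \<comment> \<open>The coordinate of a quarter centre differs from that of \<open>c\<close> by half
    of \<open>inner w u\<close>, which is also the new half-width, so the half-plane condition is
    inherited.\<close>
  have centre: "\<bar>inner w ((1/2) *\<^sub>R u)\<bar> \<le> inner w a" if "a \<in> quarter_centres c u" for a
    using that split.prems(1-3) by (auto simp: quarter_centres_def inner_add_right inner_diff_right)
  from split.prems obtain a where a: "a \<in> quarter_centres c u" and e: "e = {c, a} \<or> e \<in> Es a"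
    by blast
  from e show ?case
  proof
    assume "e = {c, a}"
    then show ?thesis using split.prems child centre[OF a] by auto
  next
    assume "e \<in> Es a"
    moreover have "0 < inner w q" if "q \<in> Qs a" for q
      using that a split.hyps(2) split.prems(4) by blast
    ultimately show ?thesis
      using split.IH a child centre split.prems(6) by blast
  qed
qed auto

text \<open>Only root edges change the sign, by 1 and over length \<open>norm u / sqrt 2\<close>,
  which fixes the constant. Every other edge stays on one side of the midline. A point of
  \<open>Q\<close> on the midline would break this, as the short leaf edge to it would change the
  sign.\<close>

lemma quad_tree_edge_potential:
  assumes T: "quad_tree \<delta> 0 u Q E" and D: "\<delta>/8 < 2 * norm u"
    and Q: "\<And>q. q \<in> Q \<Longrightarrow> inner u q \<noteq> 0" and u: "u \<noteq> 0" and e: "{x, y} \<in> E"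
  shows "norm u / sqrt 2 * \<bar>sgn (inner u x) - sgn (inner u y)\<bar> \<le> dist x y"
  using T
proof cases
  case (split Qs Es)
  have uu: "0 < inner u u" using u by simp
  from e split(1) obtain a where a: "a \<in> quarter_centres 0 u"
    and xy: "{x, y} = {0, a} \<or> {x, y} \<in> Es a" by blast
  from a obtain s t where st: "s \<in> {-1, 1}" "t \<in> {-1, 1}"
    and a_eq: "a = (s/2) *\<^sub>R u + (t/2) *\<^sub>R rotate_plane (pi/2) u"
    by (auto simp: quarter_centres_def)
  have ua: "inner u a = s/2 * inner u u"
    by (simp add: a_eq inner_add_right inner_rotate_plane_quarter)
  from xy show ?thesis
  proof
    assume "{x, y} = {0, a}"
    then have "\<bar>sgn (inner u x) - sgn (inner u y)\<bar> = \<bar>sgn (inner u a)\<bar>" "dist x y = norm a"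
      by (auto simp: doubleton_eq_iff)
    moreover have "\<bar>sgn (inner u a)\<bar> = 1"
      using uu st by (auto simp: ua sgn_mult)
    moreover have "norm a = norm u / sqrt 2"
    proof -
      have "(norm a)\<^sup>2 = (norm u / sqrt 2)\<^sup>2"
        using st
        by (auto simp: a_eq power_divide power2_norm_eq_inner inner_vec_def sum_2
            rotate_plane_quarter field_simps)
      then show ?thesis by (simp add: power2_eq_iff_nonneg)
    qed
    ultimately show ?thesis by simp
  next
    assume xyE: "{x, y} \<in> Es a"
    \<comment> \<open>The factor \<open>s\<close> orients \<open>u\<close> towards the side of the
      quarter, so both sides are treated at once.\<close>
    have pos: "0 < inner (s *\<^sub>R u) v" if "v \<in> {x, y}" for v
    proof (rule quad_tree_half_plane[OF _ _ _ _ _ xyE that])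
      show "quad_tree \<delta> a ((1/2) *\<^sub>R u) (Qs a) (Es a)" using split a by blast
      show perp: "inner (s *\<^sub>R u) (rotate_plane (pi/2) ((1/2) *\<^sub>R u)) = 0"
        by (simp add: rotate_plane_scaleR inner_rotate_plane_quarter)
      show "inner (s *\<^sub>R u) ((1/2) *\<^sub>R u) \<noteq> 0" using uu st by auto
      show le: "\<bar>inner (s *\<^sub>R u) ((1/2) *\<^sub>R u)\<bar> \<le> inner (s *\<^sub>R u) a"
        using uu st by (auto simp: ua abs_mult)
      \<comment> \<open>The quarter is closed and touches the midline, so membership gives only a
        weak inequality; \<open>Q\<close> makes it strict.\<close>
      show "0 < inner (s *\<^sub>R u) q" if q: "q \<in> Qs a" for q
      proof -
        have "q \<in> square a ((1/2) *\<^sub>R u)" "q \<in> Q" using split a q by blast+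
        then have "0 \<le> inner (s *\<^sub>R u) q" "inner u q \<noteq> 0"
          using inner_square_ge[OF _ perp] le Q by fastforce+
        then show ?thesis using st by auto
      qed
    qed
    from pos[of x] pos[of y] have "sgn (inner u x) = sgn (inner u y)"
      using st by auto
    then show ?thesis by simp
  qed
qed (use D diameter_square_ge[of u 0] in auto)

text \<open>The differences of \<open>f\<close> telescope along a walk. If no walk exists, the
  infimum is infinite and the bound is trivial.\<close>

lemma tree_dist_ge_potential:
  fixes f :: "real^2 \<Rightarrow> real"
  assumes "\<And>x y. {x, y} \<in> E \<Longrightarrow> f x - f y \<le> dist x y"
  shows "ereal (f x - f y) \<le> tree_dist E x y"
proof -
  interpret wf_digraph "graph_of E" by (rule wf_digraph_graph_of)
  have "f x - f y \<le> awalk_cost (\<lambda>(a, b). dist a b) p" if "awalk x p y" for p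
    using that
  proof (induction p arbitrary: x)
    case Nil
    then show ?case by (simp add: awalk_Nil_iff)
  next
    case (Cons e p)
    then have e: "e \<in> arcs (graph_of E)" "tail (graph_of E) e = x"
      and p: "awalk (head (graph_of E) e) p y"
      by (simp_all add: awalk_Cons_iff)
    from e obtain b where b: "e = (x, b)" "{x, b} \<in> E"
      by (cases e) (auto simp: graph_of_def)
    with p have "awalk b p y" by (simp add: graph_of_def)
    from Cons.IH[OF this] assms[OF b(2)] show ?case by (simp add: b(1))
  qed
  then show ?thesis unfolding tree_dist_def \<mu>_def by (intro INF_greatest) auto
qed

text \<open>The sign drops from 1 to -1, so the potential drops by the length of two root edges,
  however close \<open>x\<close> and \<open>y\<close> are.\<close>

lemma tree_dist_opposite_sides:
  assumes "quad_tree \<delta> 0 u Q E" "\<delta>/8 < 2 * norm u" "\<And>q. q \<in> Q \<Longrightarrow> inner u q \<noteq> 0"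
    and "0 < inner u x" "inner u y < 0"
  shows "ereal (sqrt 2 * norm u) \<le> tree_dist E x y"
proof -
  define f where "f v = norm u / sqrt 2 * sgn (inner u v)" for v
  have "u \<noteq> 0" using assms(4) by auto
  have "f a - f b \<le> dist a b" if "{a, b} \<in> E" for a b
  proof -
    have "f a - f b \<le> norm u / sqrt 2 * \<bar>sgn (inner u a) - sgn (inner u b)\<bar>"
      unfolding f_def right_diff_distrib[symmetric] by (intro mult_left_mono) auto
    also have "\<dots> \<le> dist a b"
      by (rule quad_tree_edge_potential[OF assms(1-3) \<open>u \<noteq> 0\<close> that])
    finally show ?thesis .
  qed
  from tree_dist_ge_potential[where f = f, OF this] have "ereal (f x - f y) \<le> tree_dist E x y" .
  moreover have "f x - f y = sqrt 2 * norm u"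
    using assms(4,5) by (simp add: f_def field_simps)
  ultimately show ?thesis by simp
qed

lemma stretch_ge:
  assumes "finite P" "x \<in> P" "y \<in> P" "x \<noteq> y" "finite \<T>" "\<T> \<noteq> {}"
    and "\<And>T. T \<in> \<T> \<Longrightarrow> ereal r \<le> tree_dist T x y"
  shows "ereal (r / dist x y) \<le> stretch \<T> P"
proof -
  let ?m = "\<lambda>x y. Min ((\<lambda>T. tree_dist T x y / ereal (dist x y)) ` \<T>)"
  have "ereal (r / dist x y) \<le> tree_dist T x y / ereal (dist x y)" if "T \<in> \<T>" for T
    using ereal_divide_right_mono[OF assms(7)[OF that], of "ereal (dist x y)"] assms(4) by simp
  then have "ereal (r / dist x y) \<le> ?m x y"
    using assms(5,6) by (subst Min_ge_iff) auto
  also have "\<dots> \<le> stretch \<T> P"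
    unfolding stretch_def
  proof (rule Max_ge)
    have "{?m x y | x y. x \<in> P \<and> y \<in> P \<and> x \<noteq> y} \<subseteq> (\<lambda>(x, y). ?m x y) ` (P \<times> P)" by auto
    then show "finite {?m x y | x y. x \<in> P \<and> y \<in> P \<and> x \<noteq> y}"
      using assms(1) finite_subset by blast
  qed (use assms in blast)
  finally show ?thesis .
qed

theorem mainTheorem6:
  fixes TR TB :: "(real^2) set \<Rightarrow> real^2 \<Rightarrow> real \<Rightarrow> (real^2) set set"
  assumes "\<And>P c h. admissible P c h \<Longrightarrow> red_tree P c h (TR P c h)"
    and "\<And>P c h. admissible P c h \<Longrightarrow> blue_tree P c h (TB P c h)"
  shows "(SUP (P, c, h)\<in>{(P, c, h). admissible P c h}. stretch {TR P c h, TB P c h} P)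
           \<ge> ereal (sqrt 26)"
proof -
  define p :: "real^2" where "p = vector [1/8, 0]"
  define P where "P = {p, - p}"
  have ne: "p \<noteq> - p" by (simp add: p_def vec_eq_iff forall_2)
  have d: "dist p (- p) = 1/4"
  proof -
    have "dist p (- p) = norm (2 *\<^sub>R p)" by (simp add: dist_norm scaleR_2)
    moreover have "norm p = 1/8" by (simp add: p_def norm_vec_def L2_set_def sum_2)
    ultimately show ?thesis by simp
  qed
  have "P \<subseteq> square 0 (red_vec 1)"
    unfolding P_def square_def
    by (auto simp: p_def red_vec_def rotate_plane_quarter vec_eq_iff forall_2
        intro: exI[of _ "1/8"] exI[of _ "-1/8"])
  then have adm: "admissible P 0 1"
    using ne by (simp add: admissible_def P_def)
  \<comment> \<open>An upper bound suffices: it keeps \<delta>/8 below the diameter of both root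
    squares, so both are split.\<close>
  have \<delta>: "min_dist P \<le> 1/4"
    using min_dist_props(2)[of P p "- p"] adm ne d by (simp add: admissible_def P_def)
  \<comment> \<open>The red vector is \<open>(1, 0)\<close> and the blue one \<open>(1, 1)\<close>:
    both have norm at least 1 and inner product 1/8 with \<open>p\<close>. The common bound is the
    red one.\<close>
  have far: "ereal (sqrt 2) \<le> tree_dist E p (- p)"
    if "quad_tree (min_dist P) 0 u P E" "1 \<le> norm u" "0 < inner u p" for u E
  proof -
    have "ereal (sqrt 2 * norm u) \<le> tree_dist E p (- p)"
      using that \<delta> by (intro tree_dist_opposite_sides[of "min_dist P" u P]) (auto simp: P_def)
    moreover have "sqrt 2 \<le> sqrt 2 * norm u" using that(2) by simp
    ultimately show ?thesis using order_trans ereal_less_eq(3) by blast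
  qed
  have "ereal (sqrt 2) \<le> tree_dist T p (- p)" if "T \<in> {TR P 0 1, TB P 0 1}" for T
  proof -
    have "ereal (sqrt 2) \<le> tree_dist (TR P 0 1) p (- p)"
      using assms(1)[OF adm] unfolding red_tree_def
      by (rule far) (simp_all add: p_def red_vec_def norm_vec_def L2_set_def inner_vec_def sum_2)
    moreover have "ereal (sqrt 2) \<le> tree_dist (TB P 0 1) p (- p)"
      using assms(2)[OF adm] unfolding blue_tree_def
      by (rule far) (simp_all add: p_def red_vec_def blue_vec_eq rotate_plane_quarter
          norm_vec_def L2_set_def inner_vec_def sum_2)
    ultimately show ?thesis using that by blast
  qed
  then have "ereal (sqrt 2 / dist p (- p)) \<le> stretch {TR P 0 1, TB P 0 1} P"
    using ne by (intro stretch_ge) (auto simp: P_def)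
  \<comment> \<open>Squaring reduces this to 26 \<le> 32.\<close>
  moreover have "sqrt 26 \<le> sqrt 2 / dist p (- p)"
    unfolding d by (rule real_le_lsqrt) (simp_all add: power_mult_distrib)
  ultimately have "ereal (sqrt 26) \<le> stretch {TR P 0 1, TB P 0 1} P"
    using order_trans ereal_less_eq(3) by blast
  also have "\<dots> \<le> (SUP (P, c, h)\<in>{(P, c, h). admissible P c h}. stretch {TR P c h, TB P c h} P)"
    using adm by (intro SUP_upper2[of "(P, 0, 1)"]) auto
  finally show ?thesis .
qed

end
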